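(* Let $n\ge 5$ be an integer. For any prime number $p$ and any integer $k\ge 2$, there is a finite $p$-group $G(p,k)$, nilpotent of class $n+2$, containing a right $n$-Engel element $t$ such that neither $t^{k}$ nor $t^{-1}$ is a right $n$-Engel element of $G(p,k)$.
   Context: For elements $a,b$ of a group $G$, set $[a,b]=a^{-1}b^{-1}ab$, $[a,_0 b]=a$ and $[a,_n b]=[[a,_{n-1}b],b]$ for $n\ge 1$. An element $x\in G$ is called right $n$-Engel if $[x,_n g]=1$ for all $g\in G$. *)

theory Defs
  imports "HOL-Algebra.Generated_Groups" "HOL-Computational_Algebra.Primes"
begin

definition group_commutator :: "('a, 'b) monoid_scheme \<Rightarrow> 'a \<Rightarrow> 'a \<Rightarrow> 'a"
  where "group_commutator G a b =
    inv\<^bsub>G\<^esub> a \<otimes>\<^bsub>G\<^esub> inv\<^bsub>G\<^esub> b \<otimes>\<^bsub>G\<^esub> a \<otimes>\<^bsub>G\<^esub> b"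

(* engel_commutator G n a b is the left-normed commutator [a, b, ..., b] with b taken n times. *)
primrec engel_commutator :: "('a, 'b) monoid_scheme \<Rightarrow> nat \<Rightarrow> 'a \<Rightarrow> 'a \<Rightarrow> 'a"
  where
    "engel_commutator G 0 a b = a"
  | "engel_commutator G (Suc n) a b = group_commutator G (engel_commutator G n a b) b"

definition right_engel :: "('a, 'b) monoid_scheme \<Rightarrow> nat \<Rightarrow> 'a \<Rightarrow> bool"
  where "right_engel G n x \<longleftrightarrow>
    x \<in> carrier G \<and> (\<forall>g\<in>carrier G. engel_commutator G n x g = \<one>\<^bsub>G\<^esub>)"

(* Indexed from 0: lower_central G i is the term usually written gamma_{i+1}(G). *)
primrec lower_central :: "('a, 'b) monoid_scheme \<Rightarrow> nat \<Rightarrow> 'a set"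
  where
    "lower_central G 0 = carrier G"
  | "lower_central G (Suc i) =
      generate G {group_commutator G x g | x g. x \<in> lower_central G i \<and> g \<in> carrier G}"

definition nilpotent_group :: "('a, 'b) monoid_scheme \<Rightarrow> bool"
  where "nilpotent_group G \<longleftrightarrow> group G \<and> (\<exists>c. lower_central G c = {\<one>\<^bsub>G\<^esub>})"

(* Only meaningful for nilpotent G. *)
definition nilpotency_class :: "('a, 'b) monoid_scheme \<Rightarrow> nat"
  where "nilpotency_class G = (LEAST c. lower_central G c = {\<one>\<^bsub>G\<^esub>})"

definition finite_p_group :: "nat \<Rightarrow> ('a, 'b) monoid_scheme \<Rightarrow> bool"
  where "finite_p_group p G \<longleftrightarrow> group G \<and> finite (carrier G) \<and> (\<exists>m. order G = p ^ m)"

end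

theory Submission
  imports Defs "HOL-Computational_Algebra.Polynomial"
begin

text \<open>
  Let \<open>D\<close> be the difference operator of a shift by \<open>e\<close>. The group is a finite quotient of
  \<open>\<int> \<ltimes> A\<close>, where \<open>A\<close> consists of pairs \<open>(f, w)\<close> of integer polynomials with \<open>deg f < n\<close> and
  \<open>deg w \<le> n\<close>, \<open>\<int>\<close> acts by shifts, and \<open>A\<close> has class 2 through an alternating bilinear
  differential operator \<open>B\<close> with values in the central polynomials \<open>w\<close>. For \<open>t = (f, w)\<close> the
  commutator \<open>[t,\<^sub>n g]\<close> with \<open>g = (e, a, u)\<close> is \<open>D\<^sup>n w - D\<^sup>n\<^sup>-\<^sup>1 B(f, D f)\<close> plus a term mixing
  \<open>f\<close> and \<open>a\<close>. If \<open>a = D b\<close>, the mixed term telescopes to \<open>2 D\<^sup>n B(f, b)\<close>; for \<open>f = X\<^sup>n\<^sup>-\<^sup>1\<close> it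
  vanishes as soon as \<open>B(X\<^sup>n\<^sup>-\<^sup>1, X\<^sup>n) = 0\<close>, because then \<open>B(f, b)\<close> has degree below \<open>n\<close>. The term
  \<open>D\<^sup>n w\<close> is linear in \<open>t\<close> and \<open>D\<^sup>n\<^sup>-\<^sup>1 B(f, D f)\<close> is quadratic, so choosing \<open>w\<close> to make them cancel
  for \<open>t\<close> leaves a nonzero multiple of \<open>c - c\<^sup>2\<close> for \<open>t\<^sup>c\<close>. Reducing modulo a power of \<open>p\<close> larger
  than the constants involved keeps these nonzero. Two free coefficients of \<open>B\<close> are needed, and
  this is where \<open>n \<ge> 5\<close> enters.
\<close>

subsection \<open>Commutators and homomorphisms\<close>

lemma (in group) group_commutator_closed:
  "a \<in> carrier G \<Longrightarrow> b \<in> carrier G \<Longrightarrow> group_commutator G a b \<in> carrier G"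
  by (simp add: group_commutator_def)

lemma (in group) mult_group_commutator:
  assumes "a \<in> carrier G" and "b \<in> carrier G"
  shows "b \<otimes> a \<otimes> group_commutator G a b = a \<otimes> b"
proof -
  have cancel: "x \<otimes> (inv x \<otimes> y) = y" if "x \<in> carrier G" "y \<in> carrier G" for x y
    using that by (simp add: m_assoc [symmetric])
  show ?thesis
    using assms by (simp add: group_commutator_def m_assoc cancel)
qed

text \<open>Left cancellation in \<open>b a [a,b] = a b\<close>. In this form a proposed commutator
  is checked by multiplication alone, without a formula for inverses.\<close>

lemma (in group) group_commutator_eqI:
  assumes "a \<in> carrier G" and "b \<in> carrier G" and "c \<in> carrier G"
    and "b \<otimes> a \<otimes> c = a \<otimes> b"
  shows "group_commutator G a b = c"
proof -
  have "b \<otimes> a \<otimes> group_commutator G a b = b \<otimes> a \<otimes> c"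
    using assms by (simp add: mult_group_commutator)
  then show ?thesis
    using assms by (subst (asm) Units_l_cancel) (simp_all add: group_commutator_closed)
qed

lemma (in group) lower_central_subset: "lower_central G i \<subseteq> carrier G"
proof (induction i)
  case (Suc i)
  then have "{group_commutator G x g | x g. x \<in> lower_central G i \<and> g \<in> carrier G} \<subseteq> carrier G"
    by (auto intro: group_commutator_closed)
  then show ?case
    using generate_incl by simp
qed simp

lemma group_commutator_in_lower_central:
  "x \<in> lower_central G i \<Longrightarrow> g \<in> carrier G \<Longrightarrow> group_commutator G x g \<in> lower_central G (Suc i)"
  by (auto intro: generate.incl)

lemma engel_commutator_in_lower_central:
  "x \<in> lower_central G i \<Longrightarrow> g \<in> carrier G \<Longrightarrow> engel_commutator G m x g \<in> lower_central G (i + m)"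
  by (induction m) (auto intro: group_commutator_in_lower_central simp del: lower_central.simps(2))

lemma (in group) engel_commutator_closed:
  "a \<in> carrier G \<Longrightarrow> b \<in> carrier G \<Longrightarrow> engel_commutator G m a b \<in> carrier G"
  by (induction m) (simp_all add: group_commutator_closed)

lemma (in group_hom) hom_group_commutator:
  "a \<in> carrier G \<Longrightarrow> b \<in> carrier G \<Longrightarrow>
    h (group_commutator G a b) = group_commutator H (h a) (h b)"
  by (simp add: group_commutator_def)

lemma (in group_hom) hom_engel_commutator:
  "a \<in> carrier G \<Longrightarrow> b \<in> carrier G \<Longrightarrow>
    h (engel_commutator G m a b) = engel_commutator H m (h a) (h b)"
  by (induction m) (simp_all add: hom_group_commutator G.engel_commutator_closed)

text \<open>Reduces the lower central series of a quotient to that of the group above it: a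
  surjective homomorphism maps commutators onto commutators and generated subgroups onto generated
  subgroups.\<close>

lemma (in group_hom) lower_central_image:
  assumes "h ` carrier G = carrier H"
  shows "lower_central H i = h ` lower_central G i"
proof (induction i)
  case (Suc i)
  let ?K = "{group_commutator G x g | x g. x \<in> lower_central G i \<and> g \<in> carrier G}"
  have sub: "lower_central G i \<subseteq> carrier G"
    by (rule G.lower_central_subset)
  have "{group_commutator H x g | x g. x \<in> h ` lower_central G i \<and> g \<in> h ` carrier G} = h ` ?K"
  proof (intro subset_antisym subsetI)
    fix y
    assume "y \<in> h ` ?K"
    then show "y \<in> {group_commutator H x g | x g. x \<in> h ` lower_central G i \<and> g \<in> h ` carrier G}"
      using sub hom_group_commutator by blast
  next
    fix y
    assume "y \<in> {group_commutator H x g | x g. x \<in> h ` lower_central G i \<and> g \<in> h ` carrier G}"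
    then obtain x g where "x \<in> lower_central G i" "g \<in> carrier G"
        "y = group_commutator H (h x) (h g)"
      by blast
    then show "y \<in> h ` ?K"
      using sub by (intro image_eqI [of _ _ "group_commutator G x g"]) (auto simp: hom_group_commutator)
  qed
  moreover have "?K \<subseteq> carrier G"
    using sub by (auto intro: G.group_commutator_closed)
  ultimately show ?case
    using Suc assms generate_img [of ?K] by simp
qed (use assms in simp)

text \<open>Once the series reaches the trivial group it stays there, so a nontrivial
  \<open>x\<close> at index \<open>c - 1\<close> excludes every smaller index.\<close>

lemma (in group) nilpotency_class_eqI:
  assumes "lower_central G c = {\<one>}" and "x \<in> lower_central G (c - 1)" and "x \<noteq> \<one>" and "c > 0"
  shows "nilpotency_class G = c"
  unfolding nilpotency_class_def
proof (rule Least_equality)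
  fix d
  assume d: "lower_central G d = {\<one>}"
  have "lower_central G m = {\<one>}" if "d \<le> m" for m
    using that
  proof (induction m rule: dec_induct)
    case (step m)
    have "{group_commutator G x g | x g. x = \<one> \<and> g \<in> carrier G} = {\<one>}"
      by (auto simp: group_commutator_def intro!: exI [of _ "\<one>"])
    then show ?case
      using step by (simp add: generate_one)
  qed (rule d)
  then have "\<not> d \<le> c - 1"
    using assms(2,3) by blast
  then show "c \<le> d"
    by simp
qed (rule assms)

text \<open>Stands in for a quotient group: if the fibres of \<open>r\<close> form a congruence, the
  operation descends to the image of \<open>r\<close>, where it is computed on the representatives
  chosen by \<open>s\<close>.\<close>

lemma (in group) ex_nat_image_group:
  fixes r :: "'a \<Rightarrow> nat"
  assumes "\<And>x x' y y'. \<lbrakk>x \<in> carrier G; x' \<in> carrier G; y \<in> carrier G; y' \<in> carrier G;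
    r x = r x'; r y = r y'\<rbrakk> \<Longrightarrow> r (x \<otimes> y) = r (x' \<otimes> y')"
  shows "\<exists>H :: nat monoid. group_hom G H r \<and> carrier H = r ` carrier G"
proof -
  define s where "s = inv_into (carrier G) r"
  define H :: "nat monoid" where
    "H = \<lparr>carrier = r ` carrier G, monoid.mult = (\<lambda>a b. r (s a \<otimes> s b)), one = r \<one>\<rparr>"
  have s: "s (r x) \<in> carrier G" "r (s (r x)) = r x" if "x \<in> carrier G" for x
    using that by (simp_all add: s_def inv_into_into f_inv_into_f)
  have "r (x \<otimes> y) = r (s (r x) \<otimes> s (r y))" if "x \<in> carrier G" "y \<in> carrier G" for x y
    using that s by (intro assms) auto
  then have hom: "r \<in> hom G H"
    by (auto simp: hom_def H_def)
  from hom_imp_img_group [OF this] have "group H"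
    by (simp add: H_def)
  with hom have "group_hom G H r"
    by (simp add: group_hom_def group_hom_axioms_def is_group)
  then show ?thesis
    by (auto simp: H_def)
qed

subsection \<open>Finite differences of integer polynomials\<close>

text \<open>Bounding coefficients rather than \<open>degree\<close> makes the bound 0 force the zero
  polynomial, which suits truncated subtraction of bounds.\<close>

definition polys_below :: "nat \<Rightarrow> int poly set"
  where "polys_below d = {f. \<forall>i\<ge>d. coeff f i = 0}"

lemma polys_below_0 [simp]: "polys_below 0 = {0}"
  by (auto simp: polys_below_def poly_eq_iff)

lemma polys_below_mono: "f \<in> polys_below r \<Longrightarrow> r \<le> s \<Longrightarrow> f \<in> polys_below s"
  by (auto simp: polys_below_def)

lemma polys_below_zero [simp]: "0 \<in> polys_below d"
  by (simp add: polys_below_def)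

lemma polys_below_add: "f \<in> polys_below d \<Longrightarrow> g \<in> polys_below d \<Longrightarrow> f + g \<in> polys_below d"
  and polys_below_diff: "f \<in> polys_below d \<Longrightarrow> g \<in> polys_below d \<Longrightarrow> f - g \<in> polys_below d"
  and polys_below_uminus: "f \<in> polys_below d \<Longrightarrow> - f \<in> polys_below d"
  and polys_below_smult: "f \<in> polys_below d \<Longrightarrow> smult c f \<in> polys_below d"
  by (auto simp: polys_below_def)

lemma polys_below_monom: "m < d \<Longrightarrow> monom c m \<in> polys_below d"
  by (auto simp: polys_below_def)

lemma polys_below_pCons [simp]: "pCons c f \<in> polys_below (Suc d) \<longleftrightarrow> f \<in> polys_below d"
  by (auto simp: polys_below_def coeff_pCons Suc_le_D split: nat.splits)

lemma polys_below_SucD: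
  assumes "f \<in> polys_below (Suc d)" and "coeff f d = 0"
  shows "f \<in> polys_below d"
  using assms by (auto simp: polys_below_def le_eq_less_or_eq [of d])

lemma polys_below_mult:
  assumes "f \<in> polys_below r" and "g \<in> polys_below s"
  shows "f * g \<in> polys_below (r + s - 1)"
proof (cases "f = 0 \<or> g = 0")
  case False
  have "degree h < d" if "h \<in> polys_below d" "h \<noteq> 0" for h d
    using that by (metis (mono_tags, lifting) leading_coeff_neq_0 linorder_not_le mem_Collect_eq polys_below_def)
  then have "degree f < r" "degree g < s"
    using assms False by blast+
  moreover have "degree (f * g) \<le> degree f + degree g"
    by (rule degree_mult_le)
  ultimately show ?thesis
    by (auto simp: polys_below_def intro!: coeff_eq_0)
qed auto

lemma polys_below_pderiv: "f \<in> polys_below d \<Longrightarrow> pderiv f \<in> polys_below (d - 1)"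
  by (auto simp: polys_below_def coeff_pderiv)

lemma polys_below_higher_pderiv: "f \<in> polys_below d \<Longrightarrow> (pderiv ^^ j) f \<in> polys_below (d - j)"
  by (induction j) (auto dest: polys_below_pderiv)

definition shift :: "int \<Rightarrow> int poly \<Rightarrow> int poly"
  where "shift e f = pcompose f [:e, 1:]"

definition fdiff :: "int \<Rightarrow> int poly \<Rightarrow> int poly"
  where "fdiff e f = shift e f - f"

lemma shift_simps [simp]:
  "shift e (f + g) = shift e f + shift e g"
  "shift e (f - g) = shift e f - shift e g"
  "shift e (- f) = - shift e f"
  "shift e (f * g) = shift e f * shift e g"
  "shift e (smult c f) = smult c (shift e f)"
  "shift e 0 = 0"
  by (simp_all add: shift_def pcompose_add pcompose_diff pcompose_mult pcompose_smult pcompose_uminus)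

lemma shift_zero [simp]: "shift 0 f = f"
  by (simp add: shift_def pcompose_idR)

lemma shift_shift: "shift e (shift e' f) = shift (e + e') f"
  by (simp add: shift_def pcompose_assoc [symmetric] pcompose_pCons add.commute)

lemma pderiv_shift: "pderiv (shift e f) = shift e (pderiv f)"
  by (simp add: shift_def pderiv_pcompose pderiv_pCons)

lemma higher_pderiv_shift: "(pderiv ^^ j) (shift e f) = shift e ((pderiv ^^ j) f)"
  by (induction j) (simp_all add: pderiv_shift)

lemma fdiff_simps [simp]:
  "fdiff e (f + g) = fdiff e f + fdiff e g"
  "fdiff e (f - g) = fdiff e f - fdiff e g"
  "fdiff e (- f) = - fdiff e f"
  "fdiff e (smult c f) = smult c (fdiff e f)"
  "fdiff e 0 = 0"
  by (simp_all add: fdiff_def smult_diff_right)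

lemma fdiff_zero [simp]: "fdiff 0 f = 0"
  by (simp add: fdiff_def)

lemma funpow_fdiff_simps [simp]:
  "(fdiff e ^^ m) (f + g) = (fdiff e ^^ m) f + (fdiff e ^^ m) g"
  "(fdiff e ^^ m) (f - g) = (fdiff e ^^ m) f - (fdiff e ^^ m) g"
  "(fdiff e ^^ m) (- f) = - (fdiff e ^^ m) f"
  "(fdiff e ^^ m) (smult c f) = smult c ((fdiff e ^^ m) f)"
  "(fdiff e ^^ m) 0 = 0"
  by (induction m) simp_all

text \<open>First-order Taylor expansion. Both claims share one induction because the remainder for
  \<open>pCons c g\<close> contains \<open>fdiff e g\<close>.\<close>

lemma fdiff_Taylor:
  "f \<in> polys_below m \<Longrightarrow> fdiff e f - smult e (pderiv f) \<in> polys_below (m - 2)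
     \<and> fdiff e f \<in> polys_below (m - 1)"
proof (induction f arbitrary: m)
  case 0
  then show ?case by simp
next
  case (pCons c g)
  show ?case
  proof (cases m)
    case 0
    then show ?thesis using pCons.prems by simp
  next
    case (Suc d)
    then have g: "g \<in> polys_below d"
      using pCons.prems by simp
    define \<rho> where "\<rho> = fdiff e g - smult e (pderiv g)"
    have \<rho>: "\<rho> \<in> polys_below (d - 2)" and dg: "fdiff e g \<in> polys_below (d - 1)"
      using pCons.IH [OF g] by (auto simp: \<rho>_def)
    have "shift e (pCons c g) = [:c:] + [:e, 1:] * shift e g"
      by (simp add: shift_def pcompose_pCons)
    then have "fdiff e (pCons c g) = pCons 0 (fdiff e g) + smult e (g + fdiff e g)"
      by (simp add: fdiff_def)
    also have "\<dots> = smult e (pderiv (pCons c g)) + (pCons 0 \<rho> + smult e (fdiff e g))"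
      by (simp add: \<rho>_def pderiv_pCons smult_add_right)
    finally have eq: "fdiff e (pCons c g) - smult e (pderiv (pCons c g)) =
        pCons 0 \<rho> + smult e (fdiff e g)"
      by simp
    have "pCons 0 \<rho> \<in> polys_below (d - 1)"
    proof (cases "d \<ge> 2")
      case True
      then have "d - 1 = Suc (d - 2)" by simp
      then show ?thesis using \<rho> by simp
    next
      case False
      then show ?thesis using \<rho> by simp
    qed
    then have 1: "fdiff e (pCons c g) - smult e (pderiv (pCons c g)) \<in> polys_below (m - 2)"
      unfolding eq using Suc dg by (auto intro!: polys_below_add polys_below_smult)
    have "smult e (pderiv (pCons c g)) \<in> polys_below (m - 1)"
      using polys_below_pderiv [OF pCons.prems] by (rule polys_below_smult)
    from polys_below_add [OF polys_below_mono [OF 1] this]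
    show ?thesis using 1 by simp
  qed
qed

lemma polys_below_fdiff: "f \<in> polys_below m \<Longrightarrow> fdiff e f \<in> polys_below (m - 1)"
  using fdiff_Taylor by blast

lemma polys_below_shift: "f \<in> polys_below m \<Longrightarrow> shift e f \<in> polys_below m"
  using polys_below_add [OF polys_below_mono [OF polys_below_fdiff [of f m e]], of m f]
  by (simp add: fdiff_def)

lemma polys_below_funpow_fdiff:
  "f \<in> polys_below m \<Longrightarrow> (fdiff e ^^ j) f \<in> polys_below (m - j)"
  by (induction j) (auto dest: polys_below_fdiff)

lemma coeff_fdiff:
  assumes "f \<in> polys_below (Suc (Suc d))"
  shows "coeff (fdiff e f) d = e * (int (Suc d) * coeff f (Suc d))"
proof -
  have "fdiff e f - smult e (pderiv f) \<in> polys_below d"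
    using fdiff_Taylor [OF assms, of e] by simp
  then have "coeff (fdiff e f - smult e (pderiv f)) d = 0"
    by (simp add: polys_below_def)
  then show ?thesis
    by (simp add: coeff_pderiv)
qed

text \<open>Each difference lowers the degree bound by one and multiplies the top coefficient by
  \<open>e\<close> times its degree.\<close>

lemma funpow_fdiff_top:
  "f \<in> polys_below (Suc d) \<Longrightarrow> (fdiff e ^^ d) f = [:fact d * e ^ d * coeff f d:]"
proof (induction d arbitrary: f)
  case 0
  then show ?case
    by (auto simp: polys_below_def poly_eq_iff coeff_pCons split: nat.split)
next
  case (Suc d)
  have "(fdiff e ^^ Suc d) f = (fdiff e ^^ d) (fdiff e f)"
    by (simp add: funpow_swap1)
  also have "\<dots> = [:fact d * e ^ d * coeff (fdiff e f) d:]"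
    using polys_below_fdiff [OF Suc.prems] by (intro Suc.IH) simp
  also have "\<dots> = [:fact (Suc d) * e ^ Suc d * coeff f (Suc d):]"
    using coeff_fdiff [OF Suc.prems, of e] by simp
  finally show ?case .
qed

text \<open>Over the integers a polynomial need not be a difference, because \<open>fdiff e\<close>
  of \<open>X^(d+1)\<close> has leading coefficient \<open>e (d+1)\<close>. The multiplier
  \<open>M\<close> collects these factors.\<close>

lemma multiple_in_range_fdiff:
  assumes "e \<noteq> 0" and "f \<in> polys_below d"
  shows "\<exists>M b. M \<noteq> 0 \<and> b \<in> polys_below (Suc d) \<and> smult M f = fdiff e b"
  using assms(2)
proof (induction d arbitrary: f)
  case 0
  then show ?case
    by (intro exI[of _ 1] exI[of _ 0]) simp
next
  case (Suc d)
  define c where "c = coeff f d"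
  define N where "N = e * int (Suc d)"
  define h :: "int poly" where "h = monom 1 (Suc d)"
  have h: "h \<in> polys_below (Suc (Suc d))"
    by (simp add: h_def polys_below_monom)
  have dh: "fdiff e h \<in> polys_below (Suc d)" "coeff (fdiff e h) d = N"
    using polys_below_fdiff [OF h, of e] coeff_fdiff [OF h, of e] by (simp_all add: N_def h_def)
  \<comment> \<open>Cross-multiplication cancels the coefficient of \<open>X^d\<close> without
    dividing.\<close>
  have "smult N f - smult c (fdiff e h) \<in> polys_below (Suc d)"
    using Suc.prems dh by (intro polys_below_diff polys_below_smult)
  moreover have "coeff (smult N f - smult c (fdiff e h)) d = 0"
    using dh by (simp add: c_def)
  ultimately have "smult N f - smult c (fdiff e h) \<in> polys_below d"
    by (rule polys_below_SucD)
  from Suc.IH [OF this] obtain M b where Mb: "M \<noteq> 0" "b \<in> polys_below (Suc d)"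
      "smult M (smult N f - smult c (fdiff e h)) = fdiff e b"
    by blast
  show ?case
  proof (intro exI conjI)
    show "M * N \<noteq> 0"
      using Mb assms(1) by (simp add: N_def)
    show "b + smult (M * c) h \<in> polys_below (Suc (Suc d))"
      using Mb h by (blast intro: polys_below_add polys_below_smult polys_below_mono le_SucI order_refl)
    show "smult (M * N) f = fdiff e (b + smult (M * c) h)"
      using Mb(3) by (simp add: smult_diff_right algebra_simps)
  qed
qed

lemma higher_pderiv_diff: "(pderiv ^^ j) (f - g) = (pderiv ^^ j) f - (pderiv ^^ j) (g :: int poly)"
  by (induction j) (simp_all add: pderiv_diff)

lemma higher_pderiv_uminus: "(pderiv ^^ j) (- f) = - (pderiv ^^ j) (f :: int poly)"
  by (induction j) (simp_all add: pderiv_minus)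

text \<open>The factor \<open>k!\<close> avoids the quotient \<open>m!/k!\<close>.\<close>

lemma fact_smult_higher_pderiv_monom:
  assumes "j + k = m"
  shows "smult (fact k) ((pderiv ^^ j) (monom 1 m)) = monom (fact m :: int) k"
  using assms
proof (induction j arbitrary: k)
  case (Suc j)
  have "smult (fact (Suc k)) ((pderiv ^^ Suc j) (monom (1::int) m)) =
      pderiv (smult (fact (Suc k)) ((pderiv ^^ j) (monom 1 m)))"
    by (simp add: pderiv_smult)
  also have "\<dots> = pderiv (monom (fact m) (Suc k))"
    using Suc by (subst Suc.IH) auto
  also have "\<dots> = smult (int (Suc k)) (monom (fact m) k)"
    by (simp add: pderiv_monom smult_monom)
  finally have "smult (int (Suc k)) (smult (fact k) ((pderiv ^^ Suc j) (monom 1 m))) =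
      smult (int (Suc k)) (monom (fact m :: int) k)"
    by simp
  then show ?case
    by (metis of_nat_eq_0_iff old.nat.distinct(2) smult_cancel)
qed (simp add: smult_monom)

subsection \<open>Residues of polynomials\<close>

definition residue_poly :: "int \<Rightarrow> int poly \<Rightarrow> int poly"
  where "residue_poly q f = map_poly (\<lambda>c. c mod q) f"

lemma coeff_residue_poly [simp]: "coeff (residue_poly q f) i = coeff f i mod q"
  by (simp add: residue_poly_def coeff_map_poly)

lemma residue_poly_eq_iff: "residue_poly q f = residue_poly q g \<longleftrightarrow> [:q:] dvd f - g"
  by (simp add: poly_eq_iff const_poly_dvd_iff mod_eq_dvd_iff)

text \<open>Since \<open>e - e'\<close> divides \<open>f(X + e) - f(X + e')\<close>, a shift modulo
  \<open>q\<close> depends only on the class of \<open>e\<close>. Hence the acting integers can be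
  reduced modulo \<open>q\<close> too.\<close>

lemma const_dvd_shift_diff: "[:e - e':] dvd shift e f - shift e' f"
proof (induction f)
  case (pCons c g)
  have "shift e (pCons c g) - shift e' (pCons c g) =
      [:e - e':] * shift e g + [:e', 1:] * (shift e g - shift e' g)"
    by (simp add: shift_def pcompose_pCons smult_diff_left smult_diff_right)
  then show ?case
    using pCons.IH by (metis dvd_add dvd_triv_left dvd_mult)
qed simp

lemma const_dvd_shift_cong:
  assumes "q dvd e - e'" and "[:q:] dvd f - f'"
  shows "[:q:] dvd shift e f - shift e' f'"
proof -
  obtain h where h: "f - f' = smult q h"
    using assms(2) by (auto elim: dvdE)
  have "shift e f - shift e f' = smult q (shift e h)"
    by (metis h shift_simps(2,5))
  then have "[:q:] dvd shift e f - shift e f'"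
    by (simp add: const_poly_dvd_iff)
  moreover have "[:q:] dvd shift e f' - shift e' f'"
  proof (rule dvd_trans)
    show "[:q:] dvd [:e - e':]"
      using assms(1) by simp
  qed (rule const_dvd_shift_diff)
  ultimately have "[:q:] dvd (shift e f - shift e f') + (shift e f' - shift e' f')"
    by (rule dvd_add)
  then show ?thesis by simp
qed

definition residue_polys :: "int \<Rightarrow> nat \<Rightarrow> int poly set"
  where "residue_polys q d = {f \<in> polys_below d. \<forall>i. coeff f i \<in> {0..<q}}"

lemma residue_poly_image:
  assumes "q > 0"
  shows "residue_poly q ` polys_below d = residue_polys q d"
proof (intro subset_antisym subsetI)
  fix f
  assume f: "f \<in> residue_polys q d"
  then have "f = residue_poly q f"
    by (auto simp: residue_polys_def poly_eq_iff)
  with f show "f \<in> residue_poly q ` polys_below d"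
    by (auto simp: residue_polys_def)
qed (use assms in \<open>auto simp: residue_polys_def polys_below_def\<close>)

lemma card_residue_polys:
  assumes "q > 0"
  shows "finite (residue_polys q d) \<and> card (residue_polys q d) = nat q ^ d"
proof (induction d)
  case 0
  have "residue_polys q 0 = {0}"
    using assms by (auto simp: residue_polys_def)
  then show ?case by simp
next
  case (Suc d)
  let ?F = "\<lambda>(c, f). pCons c f :: int poly"
  have "residue_polys q (Suc d) = ?F ` ({0..<q} \<times> residue_polys q d)"
  proof (intro subset_antisym subsetI)
    fix g
    assume g: "g \<in> residue_polys q (Suc d)"
    obtain c f where cf: "g = pCons c f"
      by (cases g)
    have "coeff g 0 \<in> {0..<q}" "coeff g (Suc i) \<in> {0..<q}" for i
      using g by (auto simp: residue_polys_def)
    then show "g \<in> ?F ` ({0..<q} \<times> residue_polys q d)"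
      using g by (force simp: cf residue_polys_def)
  qed (auto simp: residue_polys_def coeff_pCons split: nat.split)
  moreover have "inj_on ?F ({0..<q} \<times> residue_polys q d)"
    by (auto simp: inj_on_def)
  ultimately show ?case
    using Suc by (simp add: card_image card_cartesian_product)
qed

subsection \<open>The group of triples\<close>

locale engel_construction =
  fixes n :: nat
  assumes n5: "5 \<le> n"
begin

text \<open>The ratio of the two coefficients is forced by \<open>bracket (X\<^sup>n\<^sup>-\<^sup>1) (X\<^sup>n) = 0\<close>; the common factor
  \<open>2 n\<close> clears the denominator of the constant \<open>scale\<close> below.\<close>

definition bracket :: "int poly \<Rightarrow> int poly \<Rightarrow> int poly"
  where "bracket f g =
    smult (2 * (int n)\<^sup>2 * (int n - 4)) (f * (pderiv ^^ (n - 2)) g - (pderiv ^^ (n - 2)) f * g)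
    - smult (6 * int n * (int n - 2))
        (pderiv f * (pderiv ^^ (n - 3)) g - (pderiv ^^ (n - 3)) f * pderiv g)"

lemmas bracket_simp_rules = bracket_def higher_pderiv_add higher_pderiv_diff higher_pderiv_smult
  higher_pderiv_uminus pderiv_add pderiv_diff pderiv_minus pderiv_smult
  smult_diff_right smult_add_right

lemma bracket_simps [simp]:
  "bracket (f + g) h = bracket f h + bracket g h"
  "bracket h (f + g) = bracket h f + bracket h g"
  "bracket (f - g) h = bracket f h - bracket g h"
  "bracket h (f - g) = bracket h f - bracket h g"
  "bracket (- f) h = - bracket f h"
  "bracket h (- f) = - bracket h f"
  "bracket f f = 0"
  "bracket 0 f = 0"
  "bracket f 0 = 0"
  by (simp_all add: bracket_simp_rules algebra_simps)

lemma bracket_smult [simp]: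
  "bracket (smult c f) h = smult c (bracket f h)"
  "bracket h (smult c f) = smult c (bracket h f)"
  by (simp_all add: bracket_simp_rules mult.commute mult.left_commute)

lemma bracket_commute: "bracket g f = - bracket f g"
  by (simp add: bracket_def smult_diff_right mult.commute)

text \<open>A differential operator with constant coefficients commutes with translations; hence
  shifts act on the class 2 group by automorphisms.\<close>

lemma shift_bracket: "shift e (bracket f g) = bracket (shift e f) (shift e g)"
  by (simp add: bracket_def higher_pderiv_shift pderiv_shift)

text \<open>Every term has total differential order \<open>n - 2\<close>; strict degree bounds turn
  this into \<open>n - 1\<close>.\<close>

lemma polys_below_bracket:
  assumes "f \<in> polys_below r" and "g \<in> polys_below s"
  shows "bracket f g \<in> polys_below (r + s - (n - 1))"
proof -
  have *: "(pderiv ^^ i) f' * (pderiv ^^ j) g' \<in> polys_below (r' + s' - (n - 1))"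
    if "f' \<in> polys_below r'" "g' \<in> polys_below s'" "i + j = n - 2" for i j r' s' f' g'
  proof (cases "r' \<le> i \<or> s' \<le> j")
    \<comment> \<open>Here truncated subtraction would spoil the general estimate, but one factor
      vanishes.\<close>
    case True
    then have "(pderiv ^^ i) f' = 0 \<or> (pderiv ^^ j) g' = 0"
      using polys_below_higher_pderiv [OF that(1), of i] polys_below_higher_pderiv [OF that(2), of j]
      by auto
    then show ?thesis by auto
  next
    case False
    then have "r' - i + (s' - j) - 1 = r' + s' - (n - 1)"
      using that(3) n5 by simp
    then show ?thesis
      using polys_below_mult [OF polys_below_higher_pderiv [OF that(1), of i]
          polys_below_higher_pderiv [OF that(2), of j]]
      by simp
  qed
  show ?thesis
    unfolding bracket_def
    using n5 * [OF assms, of 0 "n - 2"] * [OF assms, of "n - 2" 0]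
      * [OF assms, of 1 "n - 3"] * [OF assms, of "n - 3" 1]
    by (auto intro!: polys_below_diff polys_below_smult)
qed

section \<open>The bracket on \<open>X^(n-1)\<close>\<close>

definition top_monom :: "int poly"
  where "top_monom = monom 1 (n - 1)"

text \<open>Up to the factor \<open>n\<close>, this is the coefficient of \<open>X^(n-1)\<close> in
  the bracket of \<open>X^(n-1)\<close> with its derivative. The factor \<open>n - 4\<close> is
  positive because \<open>5 \<le> n\<close>.\<close>

definition scale :: int
  where "scale = fact (n - 1) * (int n - 2) * (int n - 3) * (int n - 4)"

lemma scale_pos: "scale > 0"
  using n5 by (auto simp: scale_def)

lemma top_monom_below: "top_monom \<in> polys_below n"
  using n5 by (simp add: top_monom_def polys_below_monom)

text \<open>All terms are multiples of \<open>X^(n+1)\<close>, and the two antisymmetrised products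
  contribute \<open>n n! (n-2) (n-4)\<close> each, with opposite signs.\<close>

lemma bracket_top_monom_monom: "bracket top_monom (monom 1 n) = 0"
proof -
  obtain m where m: "n = m + 5"
    using n5 le_Suc_ex by (metis add.commute)
  define F :: int where "F = fact (m + 4)"
  define D where "D j k = (pderiv ^^ j) (monom (1::int) k)" for j k
  have *: "smult 2 (D (n - 2) n) = monom (int n * F) 2"
    "D (n - 2) (n - 1) = monom F 1"
    "smult 6 (D (n - 3) n) = monom (int n * F) 3"
    "smult 2 (D (n - 3) (n - 1)) = monom F 2"
    using fact_smult_higher_pderiv_monom [of "n - 2" 2 n]
      fact_smult_higher_pderiv_monom [of "n - 2" 1 "n - 1"]
      fact_smult_higher_pderiv_monom [of "n - 3" 3 n]
      fact_smult_higher_pderiv_monom [of "n - 3" 2 "n - 1"]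
    by (simp_all add: m D_def F_def fact_numeral numeral_eq_Suc del: funpow.simps)
  \<comment> \<open>The 2 and 6 in the coefficients of \<open>bracket\<close> supply the factors
    \<open>2!\<close> and \<open>3!\<close> required by the derivative formulas above.\<close>
  have "bracket top_monom (monom 1 n) =
    smult ((int n)\<^sup>2 * (int n - 4)) (top_monom * smult 2 (D (n - 2) n) - smult 2 (D (n - 2) (n - 1)) * monom 1 n)
    - smult (int n * (int n - 2))
        (pderiv top_monom * smult 6 (D (n - 3) n) - smult 3 (smult 2 (D (n - 3) (n - 1)) * pderiv (monom 1 n)))"
    by (simp add: bracket_def D_def top_monom_def smult_diff_right mult_ac)
  also have "\<dots> = 0"
    unfolding * top_monom_def
    by (simp add: m mult_monom smult_monom pderiv_monom diff_monom)
      (simp add: algebra_simps power2_eq_square)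
  finally show ?thesis .
qed

lemma coeff_bracket_top_monom_pderiv:
  "coeff (bracket top_monom (pderiv top_monom)) (n - 1) = int n * scale"
proof -
  obtain m where m: "n = m + 5"
    using n5 le_Suc_ex by (metis add.commute)
  define F :: int where "F = fact (m + 3)"
  define D where "D j k = (pderiv ^^ j) (monom (1::int) k)" for j k
  have *: "D (n - 2) (n - 2) = monom F 0"
    "D (n - 2) (n - 1) = monom ((int n - 1) * F) 1"
    "D (n - 3) (n - 2) = monom F 1"
    "smult 2 (D (n - 3) (n - 1)) = monom ((int n - 1) * F) 2"
    using fact_smult_higher_pderiv_monom [of "n - 2" 0 "n - 2"]
      fact_smult_higher_pderiv_monom [of "n - 2" 1 "n - 1"]
      fact_smult_higher_pderiv_monom [of "n - 3" 1 "n - 2"]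
      fact_smult_higher_pderiv_monom [of "n - 3" 2 "n - 1"]
    by (simp_all add: m D_def F_def fact_numeral numeral_eq_Suc del: funpow.simps)
  have p: "pderiv top_monom = smult (int n - 1) (monom 1 (n - 2))"
    unfolding top_monom_def by (simp add: pderiv_monom m smult_monom)
  have "bracket top_monom (pderiv top_monom) = smult (int n - 1) (
    smult (2 * (int n)\<^sup>2 * (int n - 4)) (top_monom * D (n - 2) (n - 2) - D (n - 2) (n - 1) * monom 1 (n - 2))
    - smult (3 * int n * (int n - 2))
        (smult 2 (pderiv top_monom * D (n - 3) (n - 2)) - smult 2 (D (n - 3) (n - 1)) * pderiv (monom 1 (n - 2))))"
    unfolding p bracket_smult
    unfolding p [symmetric]
    by (simp add: bracket_def D_def top_monom_def smult_diff_right mult_ac)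
  then show ?thesis
    unfolding * top_monom_def scale_def
    by (simp add: m mult_monom pderiv_monom fact_reduce F_def)
      (simp add: algebra_simps power2_eq_square)
qed

text \<open>The general bound gives only \<open>n + 2\<close>. Removing from \<open>b\<close> its
  terms in \<open>X^n\<close> and \<open>X^(n-1)\<close> leaves the bracket unchanged, and the rest
  has degree below \<open>n - 1\<close>.\<close>

lemma bracket_top_monom_drop:
  assumes "b \<in> polys_below (Suc n)"
  shows "bracket top_monom b \<in> polys_below n"
proof -
  define b' where "b' = b - smult (coeff b n) (monom 1 n)"
  have "b' \<in> polys_below (Suc n)"
    unfolding b'_def using assms by (intro polys_below_diff polys_below_smult polys_below_monom) auto
  then have "b' \<in> polys_below n"
    by (rule polys_below_SucD) (simp add: b'_def)
  define b'' where "b'' = b' - smult (coeff b' (n - 1)) top_monom"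
  have "b'' \<in> polys_below (Suc (n - 1))"
    unfolding b''_def using \<open>b' \<in> polys_below n\<close> n5 top_monom_below
    by (intro polys_below_diff polys_below_smult) auto
  then have "b'' \<in> polys_below (n - 1)"
    by (rule polys_below_SucD) (simp add: b''_def top_monom_def)
  then have "bracket top_monom b'' \<in> polys_below n"
    using polys_below_bracket [OF top_monom_below] by fastforce
  moreover have "bracket top_monom b = bracket top_monom b''"
    by (simp add: b''_def b'_def bracket_top_monom_monom)
  ultimately show ?thesis by simp
qed

section \<open>Third component of iterated commutators\<close>

primrec mixed_part :: "int \<Rightarrow> int poly \<Rightarrow> int poly \<Rightarrow> nat \<Rightarrow> int poly"
  where
    "mixed_part e v a 0 = 0"
  | "mixed_part e v a (Suc m) =
      fdiff e (mixed_part e v a m) + bracket (shift e ((fdiff e ^^ m) v)) a"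

text \<open>Iterating a commutator accumulates terms containing \<open>a\<close> and terms quadratic
  in \<open>v\<close> separately. The former enter with factor 2, these with a minus sign.\<close>

primrec square_part :: "int \<Rightarrow> int poly \<Rightarrow> nat \<Rightarrow> int poly"
  where
    "square_part e v 0 = 0"
  | "square_part e v (Suc m) =
      fdiff e (square_part e v m) + bracket ((fdiff e ^^ m) v) ((fdiff e ^^ Suc m) v)"

lemma mixed_part_smult:
  "mixed_part e v (smult c a) m = smult c (mixed_part e v a m)"
  "mixed_part e (smult c v) a m = smult c (mixed_part e v a m)"
  by (induction m) (simp_all add: smult_add_right)

text \<open>Quadratic scaling here, against linear scaling of the other contributions, distinguishes
  the powers of \<open>t\<close> from \<open>t\<close>.\<close>

lemma square_part_smult: "square_part e (smult c v) m = smult (c\<^sup>2) (square_part e v m)"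
  by (induction m) (simp_all add: smult_add_right power2_eq_square)

text \<open>Summation by parts: if \<open>a = fdiff e b\<close> then the sum defining \<open>mixed_part\<close> telescopes.\<close>

lemma mixed_part_fdiff:
  "mixed_part e v (fdiff e b) m =
     (fdiff e ^^ m) (bracket v b) - bracket ((fdiff e ^^ m) v) b"
proof (induction m)
  case (Suc m)
  \<comment> \<open>Product rule for differences.\<close>
  have "bracket (shift e f) (fdiff e b) = fdiff e (bracket f b) - bracket (fdiff e f) b" for f
    by (simp add: fdiff_def shift_bracket)
  then show ?case
    using Suc by simp
qed simp

text \<open>For nonzero \<open>e\<close>, a nonzero multiple of \<open>a\<close> is some
  \<open>fdiff e b\<close>. Both terms left by telescoping vanish, since
  \<open>bracket top_monom b\<close> and \<open>top_monom\<close> have degree below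
  \<open>n\<close>.\<close>

lemma mixed_part_top_monom:
  assumes "a \<in> polys_below n"
  shows "mixed_part e top_monom a n = 0"
proof (cases "e = 0")
  case True
  \<comment> \<open>For \<open>e = 0\<close> only the last summand could survive, and it contains a
    difference of \<open>top_monom\<close> because \<open>n\<close> is at least 2.\<close>
  obtain m where m: "n = Suc (Suc m)"
    using n5 by (cases n; cases "n - 1") auto
  have "mixed_part 0 top_monom a (Suc (Suc m)) = 0"
    by simp
  then show ?thesis
    using True m by metis
next
  case False
  from multiple_in_range_fdiff [OF this assms] obtain M b
    where Mb: "M \<noteq> 0" "b \<in> polys_below (Suc n)" "smult M a = fdiff e b"
    by blast
  have "(fdiff e ^^ n) top_monom = 0"
    using polys_below_funpow_fdiff [OF top_monom_below, where e = e and j = n] by simp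
  moreover have "(fdiff e ^^ n) (bracket top_monom b) = 0"
    using polys_below_funpow_fdiff [OF bracket_top_monom_drop [OF Mb(2)], where e = e and j = n] by simp
  ultimately have "smult M (mixed_part e top_monom a n) = 0"
    unfolding mixed_part_smult(1) [symmetric] Mb(3) by (simp add: mixed_part_fdiff)
  then show ?thesis
    using Mb(1) by simp
qed

text \<open>Only the coefficient of \<open>X^(n-1)\<close> survives, and for it
  \<open>fdiff e top_monom\<close> may be replaced by \<open>e\<close> times the derivative.\<close>

lemma funpow_fdiff_bracket_top_monom:
  "(fdiff e ^^ (n - 1)) (bracket top_monom (fdiff e top_monom)) = [:fact n * e ^ n * scale:]"
proof -
  define \<rho> where "\<rho> = fdiff e top_monom - smult e (pderiv top_monom)"
  have "\<rho> \<in> polys_below (n - 2)"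
    using fdiff_Taylor [OF top_monom_below] by (simp add: \<rho>_def)
  then have "bracket top_monom \<rho> \<in> polys_below (n + (n - 2) - (n - 1))"
    by (rule polys_below_bracket [OF top_monom_below])
  then have "bracket top_monom \<rho> \<in> polys_below (n - 1)"
    by (rule polys_below_mono) (use n5 in auto)
  then have 1: "coeff (bracket top_monom \<rho>) (n - 1) = 0"
    by (simp add: polys_below_def)
  have "fdiff e top_monom = smult e (pderiv top_monom) + \<rho>"
    by (simp add: \<rho>_def)
  then have "bracket top_monom (fdiff e top_monom) =
      smult e (bracket top_monom (pderiv top_monom)) + bracket top_monom \<rho>"
    by simp
  then have 2: "coeff (bracket top_monom (fdiff e top_monom)) (n - 1) = e * (int n * scale)"
    using 1 coeff_bracket_top_monom_pderiv by simp
  have "bracket top_monom (fdiff e top_monom) \<in> polys_below (n + (n - 1) - (n - 1))"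
    by (intro polys_below_bracket polys_below_fdiff top_monom_below)
  then have "bracket top_monom (fdiff e top_monom) \<in> polys_below (Suc (n - 1))"
    using n5 by simp
  from funpow_fdiff_top [OF this, of e] show ?thesis
    unfolding 2 using n5
    by (cases n) (simp_all add: mult_ac)
qed

text \<open>Passing to the next summand lowers its degree by two but saves only one application of
  \<open>fdiff e\<close>, so every summand except the first dies.\<close>

lemma square_part_top_monom: "square_part e top_monom n = [:fact n * e ^ n * scale:]"
proof -
  define \<rho> where "\<rho> m = square_part e top_monom (Suc m) -
    (fdiff e ^^ m) (bracket top_monom (fdiff e top_monom))" for m
  have "\<rho> m \<in> polys_below (n - Suc m)" for m
  proof (induction m)
    case 0
    then show ?case by (simp add: \<rho>_def)
  next
    case (Suc m)
    let ?v = "\<lambda>m. (fdiff e ^^ m) top_monom"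
    have "bracket (?v (Suc m)) (?v (Suc (Suc m))) \<in>
        polys_below (n - Suc m + (n - Suc (Suc m)) - (n - 1))"
      by (intro polys_below_bracket polys_below_funpow_fdiff top_monom_below)
    then have "bracket (?v (Suc m)) (?v (Suc (Suc m))) \<in> polys_below (n - Suc (Suc m))"
      by (rule polys_below_mono) auto
    moreover have "fdiff e (\<rho> m) \<in> polys_below (n - Suc (Suc m))"
      using polys_below_fdiff [OF Suc] by simp
    moreover have "\<rho> (Suc m) = fdiff e (\<rho> m) + bracket (?v (Suc m)) (?v (Suc (Suc m)))"
      by (simp add: \<rho>_def)
    ultimately show ?case
      by (simp only: polys_below_add)
  qed
  from this [of "n - 1"] have "\<rho> (n - 1) = 0"
    using n5 by simp
  then show ?thesis
    using n5 funpow_fdiff_bracket_top_monom [of e] by (simp add: \<rho>_def del: square_part.simps)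
qed

section \<open>The infinite group and its commutators\<close>

definition triples :: "(int \<times> int poly \<times> int poly) monoid"
  where "triples = \<lparr>carrier = UNIV \<times> polys_below n \<times> polys_below (Suc n),
    monoid.mult = (\<lambda>(e, f, w) (e', f', w').
      (e + e', shift e' f + f', shift e' w + w' + bracket (shift e' f) f')),
    one = (0, 0, 0)\<rparr>"

lemma carrier_triples [simp]:
    "(e, f, w) \<in> carrier triples \<longleftrightarrow> f \<in> polys_below n \<and> w \<in> polys_below (Suc n)"
  and mult_triples [simp]: "(e, f, w) \<otimes>\<^bsub>triples\<^esub> (e', f', w') =
      (e + e', shift e' f + f', shift e' w + w' + bracket (shift e' f) f')"
  and one_triples [simp]: "\<one>\<^bsub>triples\<^esub> = (0, 0, 0)"
  by (simp_all add: triples_def)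

lemma bracket_closed:
  "f \<in> polys_below n \<Longrightarrow> g \<in> polys_below n \<Longrightarrow> bracket f g \<in> polys_below (Suc n)"
  using polys_below_bracket [of f n g n] n5 by simp

lemmas triples_closed = polys_below_add polys_below_diff polys_below_uminus polys_below_smult
  polys_below_shift bracket_closed

lemma group_triples: "group triples"
proof (rule groupI)
  fix x y z
  assume "x \<in> carrier triples" "y \<in> carrier triples" "z \<in> carrier triples"
  show "x \<otimes>\<^bsub>triples\<^esub> y \<otimes>\<^bsub>triples\<^esub> z = x \<otimes>\<^bsub>triples\<^esub> (y \<otimes>\<^bsub>triples\<^esub> z)"
    by (cases x; cases y; cases z) (simp add: shift_bracket shift_shift ac_simps)
next
  fix x y
  assume "x \<in> carrier triples" "y \<in> carrier triples"
  then show "x \<otimes>\<^bsub>triples\<^esub> y \<in> carrier triples"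
    by (cases x; cases y) (simp add: triples_closed)
next
  fix x
  assume "x \<in> carrier triples"
  then show "\<exists>y\<in>carrier triples. y \<otimes>\<^bsub>triples\<^esub> x = \<one>\<^bsub>triples\<^esub>"
  proof (cases x)
    case (fields e f w)
    show ?thesis
      \<comment> \<open>No bracket correction appears in the inverse because
        \<open>bracket f f = 0\<close>.\<close>
      by (rule bexI [of _ "(- e, - shift (- e) f, - shift (- e) w)"])
        (use \<open>x \<in> carrier triples\<close> in \<open>simp_all add: fields shift_shift triples_closed\<close>)
  qed
qed auto

sublocale G: group triples
  by (rule group_triples)

text \<open>The factor 2 arises from \<open>B(S f, a) - B(a, S f)\<close>, where \<open>S\<close> is
  the shift and \<open>B\<close> is alternating.\<close>

lemma group_commutator_triples:
  assumes "(0, f, w) \<in> carrier triples" and "(e, a, u) \<in> carrier triples"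
  shows "group_commutator triples (0, f, w) (e, a, u) =
    (0, fdiff e f, fdiff e w + smult 2 (bracket (shift e f) a) - bracket f (fdiff e f))"
proof (rule G.group_commutator_eqI [OF assms])
  have two: "smult 2 p = p + p" for p :: "int poly"
    using smult_add_left [of 1 1 p] by simp
  show "(0, fdiff e f, fdiff e w + smult 2 (bracket (shift e f) a) - bracket f (fdiff e f))
      \<in> carrier triples"
    using assms by (simp add: triples_closed fdiff_def)
  show "(e, a, u) \<otimes>\<^bsub>triples\<^esub> (0, f, w) \<otimes>\<^bsub>triples\<^esub>
      (0, fdiff e f, fdiff e w + smult 2 (bracket (shift e f) a) - bracket f (fdiff e f)) =
    (0, f, w) \<otimes>\<^bsub>triples\<^esub> (e, a, u)"
    using bracket_commute [of a f] bracket_commute [of a "shift e f"]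
    by (simp add: fdiff_def two)
qed

lemma engel_commutator_triples:
  assumes "(0, f, w) \<in> carrier triples" and "(e, a, u) \<in> carrier triples"
  shows "engel_commutator triples m (0, f, w) (e, a, u) =
    (0, (fdiff e ^^ m) f,
      (fdiff e ^^ m) w + smult 2 (mixed_part e f a m) - square_part e f m)"
proof (induction m)
  case (Suc m)
  have "engel_commutator triples m (0, f, w) (e, a, u) \<in> carrier triples"
    using assms by (rule G.engel_commutator_closed)
  then show ?case
    using Suc assms by (simp add: group_commutator_triples smult_add_right)
qed simp

text \<open>The third component makes its \<open>n\<close>-th difference cancel the square part when
  \<open>c = 1\<close>. Multiples of \<open>top_monom\<close> have zero bracket with each other, so
  the powers and the inverse of \<open>engel_elt 1\<close> stay in this family.\<close>

definition engel_elt :: "int \<Rightarrow> int \<times> int poly \<times> int poly"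
  where "engel_elt c = (0, smult c top_monom, monom (c * scale) n)"

lemma engel_elt_closed: "engel_elt c \<in> carrier triples"
  by (simp add: engel_elt_def polys_below_smult top_monom_below polys_below_monom)

lemma engel_elt_pow: "engel_elt 1 [^]\<^bsub>triples\<^esub> (k::nat) = engel_elt (int k)"
  by (induction k) (simp_all add: engel_elt_def smult_add_left add_monom algebra_simps)

lemma engel_elt_inv: "inv\<^bsub>triples\<^esub> (engel_elt 1) = engel_elt (- 1)"
  by (rule G.inv_equality) (simp_all add: engel_elt_closed, simp add: engel_elt_def add_monom)

lemma engel_commutator_engel_elt:
  assumes "(e, a, u) \<in> carrier triples"
  shows "engel_commutator triples n (engel_elt c) (e, a, u) =
    (0, 0, [:fact n * e ^ n * scale * (c - c\<^sup>2):])"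
proof -
  have "(fdiff e ^^ n) top_monom = 0"
    using polys_below_funpow_fdiff [OF top_monom_below, where e = e and j = n] by simp
  moreover have "(fdiff e ^^ n) (monom (c * scale) n) = [:fact n * e ^ n * (c * scale):]"
    using funpow_fdiff_top [of "monom (c * scale) n" n e] by (simp add: polys_below_monom)
  ultimately show ?thesis
    using engel_commutator_triples [OF engel_elt_closed [of c, unfolded engel_elt_def] assms, of n] assms
    by (simp add: engel_elt_def mixed_part_smult mixed_part_top_monom square_part_smult
        square_part_top_monom algebra_simps)
qed

text \<open>Weights: the generator of \<open>\<int>\<close> and \<open>X\<^sup>n\<^sup>-\<^sup>1\<close> in the second component have weight 1, and
  \<open>X\<^sup>d\<close> has weight \<open>n - d\<close> in the second and \<open>n + 2 - d\<close> in the third component.\<close>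

definition weight_filtration :: "nat \<Rightarrow> (int \<times> int poly \<times> int poly) set"
  where "weight_filtration i = {(e, f, w) \<in> carrier triples.
    (i > 0 \<longrightarrow> e = 0) \<and> f \<in> polys_below (n - i) \<and> w \<in> polys_below (n + 2 - i)}"

lemma subgroup_weight_filtration: "subgroup (weight_filtration (Suc i)) triples"
proof (rule G.subgroupI)
  have br: "bracket f g \<in> polys_below (n + 2 - Suc i)"
    if "f \<in> polys_below (n - Suc i)" "g \<in> polys_below (n - Suc i)" for f g
    by (rule polys_below_mono [OF polys_below_bracket [OF that]]) (use n5 in auto)
  show "inv\<^bsub>triples\<^esub> a \<in> weight_filtration (Suc i)" if a: "a \<in> weight_filtration (Suc i)" for a
  proof -
    obtain f w where "a = (0, f, w)"
      using a by (auto simp: weight_filtration_def)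
    moreover from this have "inv\<^bsub>triples\<^esub> a = (0, - f, - w)"
      using a by (intro G.inv_equality) (auto simp: weight_filtration_def intro: polys_below_uminus)
    ultimately show ?thesis
      using a by (auto simp: weight_filtration_def intro: polys_below_uminus)
  qed
  show "a \<otimes>\<^bsub>triples\<^esub> b \<in> weight_filtration (Suc i)"
    if "a \<in> weight_filtration (Suc i)" "b \<in> weight_filtration (Suc i)" for a b
    using that br by (auto simp: weight_filtration_def intro!: polys_below_add bracket_closed)
  show "weight_filtration (Suc i) \<noteq> {}"
    by (auto simp: weight_filtration_def intro!: exI[of _ 0])
qed (auto simp: weight_filtration_def)

text \<open>Differences lower both degree bounds by one. Bracketing a polynomial below
  \<open>n - i\<close> with one below \<open>n\<close> gives one below \<open>n + 1 - i\<close>, the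
  bound required at \<open>Suc i\<close>.\<close>

lemma group_commutator_weight_filtration:
  assumes "x \<in> weight_filtration i" and "g \<in> carrier triples"
  shows "group_commutator triples x g \<in> weight_filtration (Suc i)"
proof -
  obtain e f w e' a u where x: "x = (e, f, w)" and g: "g = (e', a, u)"
    by (metis prod_cases3)
  have xc: "x \<in> carrier triples"
    using assms(1) by (auto simp: weight_filtration_def)
  have cc: "group_commutator triples x g \<in> carrier triples"
    using G.group_commutator_closed [OF xc assms(2)] .
  show ?thesis
  proof (cases i)
    case 0
    \<comment> \<open>At index 0 the first entry of \<open>x\<close> may be nonzero and the
      commutator formula does not apply. The second component is read off from the defining
      equation; the carrier already bounds the third.\<close>
    obtain c1 c2 c3 where c: "group_commutator triples x g = (c1, c2, c3)"
      by (metis prod_cases3)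
    have eq: "g \<otimes>\<^bsub>triples\<^esub> x \<otimes>\<^bsub>triples\<^esub> (c1, c2, c3) = x \<otimes>\<^bsub>triples\<^esub> g"
      using G.mult_group_commutator [OF xc assms(2)] c by simp
    then have c1: "c1 = 0"
      by (simp add: x g)
    with eq have "shift e a + f + c2 = shift e' f + a"
      by (simp add: x g)
    then have "c2 = fdiff e' f - fdiff e a"
      by (simp add: fdiff_def algebra_simps)
    then have "c2 \<in> polys_below (n - 1)"
      using xc assms(2) polys_below_fdiff [of f n e'] polys_below_fdiff [of a n e]
      by (auto simp: x g intro: polys_below_diff)
    then show ?thesis
      using cc 0 c1 by (simp add: c weight_filtration_def)
  next
    case (Suc j)
    then have e: "e = 0" and f: "f \<in> polys_below (n - i)" and w: "w \<in> polys_below (n + 2 - i)"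
      using assms(1) by (auto simp: weight_filtration_def x)
    have a: "a \<in> polys_below n"
      using assms(2) by (simp add: g)
    have br: "bracket f' g' \<in> polys_below (Suc n - i)"
      if f': "f' \<in> polys_below (n - i)" and g': "g' \<in> polys_below n" for f' g'
    proof (cases "n - i = 0")
      case True
      then show ?thesis using f' by simp
    next
      case False
      then show ?thesis
        by (intro polys_below_mono [OF polys_below_bracket [OF f' g']]) auto
    qed
    have "fdiff e' f \<in> polys_below (n - Suc i)"
      using polys_below_fdiff [OF f, of e'] by simp
    moreover from this have "fdiff e' f \<in> polys_below n"
      by (rule polys_below_mono) simp
    moreover have "fdiff e' w \<in> polys_below (n + 2 - Suc i)"
      using polys_below_fdiff [OF w, of e'] by simp
    moreover have "group_commutator triples x g =
        (0, fdiff e' f, fdiff e' w + smult 2 (bracket (shift e' f) a) - bracket f (fdiff e' f))"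
      using group_commutator_triples [of f w e' a u] xc assms(2) by (simp add: x g e)
    ultimately show ?thesis
      using cc f a
      by (auto simp: weight_filtration_def
          intro!: polys_below_add polys_below_diff polys_below_smult br polys_below_shift)
  qed
qed

lemma lower_central_triples: "lower_central triples i \<subseteq> weight_filtration i"
proof (induction i)
  case 0
  then show ?case
    by (auto simp: weight_filtration_def intro: polys_below_mono)
next
  case (Suc i)
  show ?case
    unfolding lower_central.simps
    by (rule G.generate_subgroup_incl [OF _ subgroup_weight_filtration])
      (use Suc group_commutator_weight_filtration in blast)
qed

lemma lower_central_triples_trivial: "lower_central triples (n + 2) = {\<one>\<^bsub>triples\<^esub>}"
proof -
  have "weight_filtration (n + 2) \<subseteq> {(0, 0, 0)}"
    by (auto simp: weight_filtration_def)
  moreover have "\<one>\<^bsub>triples\<^esub> \<in> lower_central triples (n + 2)"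
    by (simp add: generate.one del: one_triples)
  ultimately show ?thesis
    using lower_central_triples [of "n + 2"] by auto
qed

text \<open>With \<open>x\<close> generating the integers and \<open>t\<close> the Engel element,
  \<open>[[t,x],t]\<close> lives in the third component alone; \<open>n - 1\<close> further
  commutators with \<open>x\<close> reduce it to a nonzero constant.\<close>

lemma lower_central_triples_witness:
  "(0, 0, [:- (2 * fact n * scale):]) \<in> lower_central triples (n + 1)"
proof -
  define x where "x = (1 :: int, 0 :: int poly, 0 :: int poly)"
  define w1 where "w1 = fdiff 1 (monom scale n) - bracket top_monom (fdiff 1 top_monom)"
  define w2 where "w2 = smult 2 (bracket (fdiff 1 top_monom) top_monom)"
  have x: "x \<in> carrier triples"
    by (simp add: x_def)
  have t: "(0, top_monom, monom scale n) \<in> carrier triples"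
    using engel_elt_closed [of 1] by (simp add: engel_elt_def)
  have "group_commutator triples (0, top_monom, monom scale n) x = (0, fdiff 1 top_monom, w1)"
    using group_commutator_triples [OF t x [unfolded x_def]] by (simp add: x_def w1_def)
  then have 1: "(0, fdiff 1 top_monom, w1) \<in> lower_central triples 1"
    using group_commutator_in_lower_central [of "(0, top_monom, monom scale n)" triples 0 x] t x
    by simp
  then have c1: "(0, fdiff 1 top_monom, w1) \<in> carrier triples"
    using G.lower_central_subset by blast
  have "group_commutator triples (0, fdiff 1 top_monom, w1) (0, top_monom, monom scale n) = (0, 0, w2)"
    using group_commutator_triples [OF c1 t] by (simp add: w2_def)
  then have 2: "(0, 0, w2) \<in> lower_central triples 2"
    using group_commutator_in_lower_central [OF 1 t] by (simp add: numeral_2_eq_2 del: lower_central.simps)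
  then have c2: "(0, 0, w2) \<in> carrier triples"
    using G.lower_central_subset by blast
  have z: "mixed_part e 0 a m = 0" "square_part e 0 m = 0" for e a m
    by (induction m) simp_all
  have "w2 = smult (- 2) (bracket top_monom (fdiff 1 top_monom))"
    unfolding w2_def by (subst bracket_commute) simp
  then have "engel_commutator triples (n - 1) (0, 0, w2) x = (0, 0, [:- (2 * fact n * scale):])"
    using engel_commutator_triples [OF c2 x [unfolded x_def], of "n - 1"] funpow_fdiff_bracket_top_monom [of 1]
    by (simp add: x_def z mult.assoc)
  moreover have "2 + (n - 1) = n + 1"
    using n5 by simp
  ultimately show ?thesis
    using engel_commutator_in_lower_central [OF 2 x, of "n - 1"] by metis
qed

section \<open>Reduction modulo \<open>q\<close>\<close>

definition residue_triple :: "int \<Rightarrow> int \<times> int poly \<times> int poly \<Rightarrow> int \<times> int poly \<times> int poly"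
  where "residue_triple q = map_prod (\<lambda>e. e mod q) (map_prod (residue_poly q) (residue_poly q))"

lemma residue_triple_eq_iff:
  "residue_triple q (e, f, w) = residue_triple q (e', f', w') \<longleftrightarrow>
    q dvd e - e' \<and> [:q:] dvd f - f' \<and> [:q:] dvd w - w'"
  by (simp add: residue_triple_def residue_poly_eq_iff mod_eq_dvd_iff)

lemma const_dvd_bracket:
  assumes "[:q:] dvd f"
  shows "[:q:] dvd bracket f g" and "[:q:] dvd bracket g f"
proof -
  obtain h where "f = smult q h"
    using assms by (auto elim: dvdE)
  then show "[:q:] dvd bracket f g" "[:q:] dvd bracket g f"
    by (simp_all add: const_poly_dvd_iff)
qed

lemma residue_triple_mult_cong:
  assumes "residue_triple q x = residue_triple q x'" and "residue_triple q y = residue_triple q y'"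
  shows "residue_triple q (x \<otimes>\<^bsub>triples\<^esub> y) = residue_triple q (x' \<otimes>\<^bsub>triples\<^esub> y')"
proof -
  obtain e f w e' f' w' where x: "x = (e, f, w)" "x' = (e', f', w')"
    by (metis prod_cases3)
  obtain c g u c' g' u' where y: "y = (c, g, u)" "y' = (c', g', u')"
    by (metis prod_cases3)
  have ef: "q dvd e - e'" "[:q:] dvd f - f'" "[:q:] dvd w - w'"
    and cg: "q dvd c - c'" "[:q:] dvd g - g'" "[:q:] dvd u - u'"
    using assms by (simp_all add: x y residue_triple_eq_iff)
  have sf: "[:q:] dvd shift c f - shift c' f'" and sw: "[:q:] dvd shift c w - shift c' w'"
    using ef cg by (simp_all add: const_dvd_shift_cong)
  \<comment> \<open>Bilinearity allows changing one argument at a time.\<close>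
  have "[:q:] dvd bracket (shift c f - shift c' f') g + bracket (shift c' f') (g - g')"
    using sf cg by (intro dvd_add const_dvd_bracket)
  then have "[:q:] dvd bracket (shift c f) g - bracket (shift c' f') g'"
    by simp
  then have "[:q:] dvd (shift c w - shift c' w') + (u - u') +
      (bracket (shift c f) g - bracket (shift c' f') g')"
    using sw cg by (intro dvd_add)
  moreover have "[:q:] dvd (shift c f - shift c' f') + (g - g')"
    using sf cg by (intro dvd_add)
  moreover have "q dvd (e - e') + (c - c')"
    using ef cg by (intro dvd_add)
  ultimately show ?thesis
    by (simp add: x y residue_triple_eq_iff algebra_simps)
qed

lemma residue_triple_image:
  assumes "q > 0"
  shows "residue_triple q ` carrier triples =
    {0..<q} \<times> residue_polys q n \<times> residue_polys q (Suc n)"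
proof -
  have "(\<lambda>e. e mod q) ` UNIV = {0..<q}"
  proof (intro subset_antisym subsetI)
    fix e
    assume "e \<in> {0..<q}"
    then have "e = e mod q" by simp
    then show "e \<in> range (\<lambda>e. e mod q)" by blast
  qed (use assms in auto)
  then show ?thesis
    using assms
    by (simp add: triples_def residue_triple_def map_prod_surj_on residue_poly_image)
qed

lemma card_residue_triples:
  assumes "q > 0"
  shows "finite (residue_triple q ` carrier triples)"
    and "card (residue_triple q ` carrier triples) = nat q ^ (2 * n + 2)"
proof -
  show "finite (residue_triple q ` carrier triples)"
    using card_residue_polys [OF assms] by (simp add: residue_triple_image [OF assms])
  have "2 * n + 2 = 1 + n + Suc n" by simp
  then show "card (residue_triple q ` carrier triples) = nat q ^ (2 * n + 2)"
    using card_residue_polys [OF assms]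
    by (simp only: residue_triple_image [OF assms] card_cartesian_product power_add) simp
qed

end

section \<open>The finite quotient and its Engel elements\<close>

theorem mainTheorem7:
  fixes n p k :: nat
  assumes "n \<ge> 5" and "prime p" and "k \<ge> 2"
  shows "\<exists>G :: nat monoid.
    finite_p_group p G \<and> nilpotent_group G \<and> nilpotency_class G = n + 2 \<and>
    (\<exists>t\<in>carrier G. right_engel G n t \<and>
       \<not> right_engel G n (t [^]\<^bsub>G\<^esub> k) \<and> \<not> right_engel G n (inv\<^bsub>G\<^esub> t))"
proof -
  interpret engel_construction n
    by unfold_locales (rule assms)
  define C where "C = fact n * scale"
  have C: "C > 0"
    using scale_pos by (simp add: C_def)
  \<comment> \<open>The modulus must exceed \<open>C * |m|\<close> for \<open>m = 2\<close>,
    \<open>-2\<close> and \<open>k - k^2\<close>. A common bound is \<open>2 * C * k^2\<close>, and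
    \<open>N < p ^ N\<close> puts a power of \<open>p\<close> above it.\<close>
  define N where "N = nat (2 * C * int k ^ 2)"
  define q where "q = int p ^ N"
  have "N < p ^ N"
    using prime_ge_2_nat [OF assms(2)] by (meson less_exp less_le_trans power_mono zero_le)
  then have "int N < q"
    by (simp add: q_def flip: of_nat_power)
  then have q: "2 * C * int k ^ 2 < q"
    using C by (simp add: N_def)
  have q0: "q > 0"
    using assms(2) prime_gt_0_nat by (simp add: q_def)
  have not_dvd: "\<not> q dvd C * m" if "m \<noteq> 0" "\<bar>m\<bar> \<le> 2 * int k ^ 2" for m
  proof
    assume "q dvd C * m"
    then have "q dvd C * \<bar>m\<bar>"
      using C by (metis abs_mult abs_of_pos dvd_abs_iff)
    then have "q \<le> C * \<bar>m\<bar>"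
      using that(1) C by (intro zdvd_imp_le) auto
    also have "\<dots> \<le> C * (2 * int k ^ 2)"
      using that(2) C by (intro mult_left_mono) auto
    finally show False
      using q by simp
  qed
  have k2: "2 * int k \<le> int k ^ 2"
    using assms(3) by (simp add: power2_eq_square)

  let ?R = "residue_triple q ` carrier triples"
  from finite_imp_inj_to_nat_seg [OF card_residue_triples(1) [OF q0]]
  obtain enc :: "int \<times> int poly \<times> int poly \<Rightarrow> nat" where enc: "inj_on enc ?R"
    by blast
  define r where "r = enc \<circ> residue_triple q"
  have r_eq: "r x = r y \<longleftrightarrow> residue_triple q x = residue_triple q y"
    if "x \<in> carrier triples" "y \<in> carrier triples" for x y
    using that enc by (auto simp: r_def inj_on_eq_iff)
  have "\<exists>H :: nat monoid. group_hom triples H r \<and> carrier H = r ` carrier triples"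
  proof (rule G.ex_nat_image_group)
    fix x x' y y'
    assume "x \<in> carrier triples" "x' \<in> carrier triples" "y \<in> carrier triples"
      "y' \<in> carrier triples" "r x = r x'" "r y = r y'"
    then have "residue_triple q (x \<otimes>\<^bsub>triples\<^esub> y) = residue_triple q (x' \<otimes>\<^bsub>triples\<^esub> y')"
      by (intro residue_triple_mult_cong) (simp_all add: r_eq)
    then show "r (x \<otimes>\<^bsub>triples\<^esub> y) = r (x' \<otimes>\<^bsub>triples\<^esub> y')"
      by (simp add: r_def)
  qed
  then obtain H :: "nat monoid" where "group_hom triples H r"
      and carrier_H: "carrier H = r ` carrier triples"
    by blast
  interpret r: group_hom triples H r by fact

  have const_eq_one: "r (0, 0, [:c:]) = \<one>\<^bsub>H\<^esub> \<longleftrightarrow> q dvd c" for c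
  proof -
    have "r (0, 0, [:c:]) = r (0, 0, 0) \<longleftrightarrow> q dvd c"
      by (subst r_eq) (auto simp: residue_triple_eq_iff)
    then show ?thesis
      using r.hom_one by simp
  qed

  have carrier_H_enc: "carrier H = enc ` ?R"
    by (simp add: carrier_H r_def image_comp)
  have nat_q: "nat q = p ^ N"
    by (simp add: q_def flip: of_nat_power)
  have "card (carrier H) = card ?R"
    using enc by (simp add: carrier_H_enc card_image)
  also have "\<dots> = p ^ (N * (2 * n + 2))"
    by (simp only: card_residue_triples(2) [OF q0] nat_q power_mult)
  finally have card: "card (carrier H) = p ^ (N * (2 * n + 2))" .
  have "finite (carrier H)"
    using card_residue_triples(1) [OF q0] by (simp add: carrier_H_enc)
  then have pgroup: "finite_p_group p H"
    using card by (auto simp: finite_p_group_def Coset.order_def r.H.is_group)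

  have lc: "lower_central H (n + 2) = {\<one>\<^bsub>H\<^esub>}"
    using r.lower_central_image [OF carrier_H [symmetric], of "n + 2"] r.hom_one
    by (simp only: lower_central_triples_trivial) simp
  have "r (0, 0, [:- (2 * fact n * scale):]) \<in> lower_central H (n + 1)"
    using r.lower_central_image [OF carrier_H [symmetric], of "n + 1"]
      lower_central_triples_witness by blast
  \<comment> \<open>The witness survives reduction, so the class does not drop in the
    quotient.\<close>
  moreover have "\<not> q dvd - (2 * fact n * scale)"
    using not_dvd [of 2] assms(3) k2 by (simp add: C_def mult_ac)
  ultimately have cls: "nilpotency_class H = n + 2"
    by (intro r.H.nilpotency_class_eqI [OF lc, where x = "r (0, 0, [:- (2 * fact n * scale):])"])
      (simp_all only: const_eq_one, simp_all)

  \<comment> \<open>The commutator is the constant \<open>C (c - c^2) e^n\<close>, so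
    \<open>e = 1\<close> is the decisive case.\<close>
  have engel: "right_engel H n (r (engel_elt c)) \<longleftrightarrow> q dvd C * (c - c\<^sup>2)" for c
  proof -
    have *: "engel_commutator H n (r (engel_elt c)) (r (e, a, u)) = \<one>\<^bsub>H\<^esub> \<longleftrightarrow>
        q dvd C * (c - c\<^sup>2) * e ^ n" if "(e, a, u) \<in> carrier triples" for e a u
    proof -
      have "engel_commutator H n (r (engel_elt c)) (r (e, a, u)) =
          r (0, 0, [:C * (c - c\<^sup>2) * e ^ n:])"
        using r.hom_engel_commutator [OF engel_elt_closed that, of n c]
        by (simp add: engel_commutator_engel_elt [OF that] C_def mult_ac)
      then show ?thesis
        by (simp only: const_eq_one)
    qed
    show ?thesis
    proof
      assume "right_engel H n (r (engel_elt c))"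
      then have "engel_commutator H n (r (engel_elt c)) (r (1, 0, 0)) = \<one>\<^bsub>H\<^esub>"
        by (simp add: right_engel_def)
      then show "q dvd C * (c - c\<^sup>2)"
        by (subst (asm) *) auto
    next
      assume "q dvd C * (c - c\<^sup>2)"
      then have "\<forall>g \<in> carrier triples. engel_commutator H n (r (engel_elt c)) (r g) = \<one>\<^bsub>H\<^esub>"
        using * by auto
      then show "right_engel H n (r (engel_elt c))"
        using engel_elt_closed by (auto simp: right_engel_def carrier_H)
    qed
  qed
  define t where "t = r (engel_elt 1)"
  have "right_engel H n t"
    by (simp add: t_def engel)
  moreover have "t [^]\<^bsub>H\<^esub> k = r (engel_elt (int k))"
    using engel_elt_closed by (simp add: t_def engel_elt_pow flip: r.hom_nat_pow)
  moreover have "\<not> q dvd C * (int k - (int k)\<^sup>2)"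
    by (intro not_dvd) (use k2 assms(3) in \<open>linarith, simp\<close>)
  moreover have "inv\<^bsub>H\<^esub> t = r (engel_elt (- 1))"
    using engel_elt_closed by (simp add: t_def flip: engel_elt_inv)
  moreover have "\<not> q dvd C * (- 1 - (- 1)\<^sup>2)"
    using k2 assms(3) by (intro not_dvd) auto
  ultimately have "t \<in> carrier H \<and> right_engel H n t \<and> \<not> right_engel H n (t [^]\<^bsub>H\<^esub> k) \<and>
      \<not> right_engel H n (inv\<^bsub>H\<^esub> t)"
    using engel by (simp add: right_engel_def)
  moreover have "nilpotent_group H"
    using lc r.H.is_group unfolding nilpotent_group_def by blast
  ultimately show ?thesis
    using pgroup cls by blast
qed

end
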